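(* Let $G$ be a finite bipartite graph with parts $L\sqcup R$, left-regular of degree $d$, let $n=|L|$, and let $s,h$ be positive integers with $s\ge 2$ and $\max(s,h)\le n$. If $h\ge s$ then $$\alpha_G(h)\ge d-\frac{h-1}{s-1}\bigl(d-\alpha_G(s)\bigr).$$ In particular, if $G$ is an $s$-optimal small-set expander of left degree $d$, then $$\alpha_G(h)\ge d-\frac{h-1}{s}$$ for every integer $h$ with $s\le h\le n$.
   Context: Graphs are finite and simple. A bipartite graph $G$ with parts $L\sqcup R$ is left-regular of degree $d$ if every vertex of $L$ has exactly $d$ incident edges. For $X\subseteq L$, $N(X)\subseteq R$ is the set of vertices adjacent to at least one vertex of $X$. For an integer $1\le t\le |L|$, $$\alpha_G(t):=\min\left\{\frac{|N(X)|}{|X|}: X\subseteq L,\ 0<|X|\le t\right\}.$$ A left-regular bipartite graph $G$ of degree $d$ is an $s$-optimal small-set expander if $\alpha_G(t)\ge (d-1)+\frac1t$ for every integer $t$ with $1\le t\le s$. *)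

theory Defs
  imports Complex_Main
begin

text \<open>
  Edges are two-element vertex sets; together with disjointness of the parts this makes the
  graph simple and bipartite. Isolated vertices are allowed on either side.
\<close>

definition bipartite_graph :: "'a set \<Rightarrow> 'a set \<Rightarrow> 'a set set \<Rightarrow> bool" where
  "bipartite_graph L R E \<longleftrightarrow>
     finite L \<and> finite R \<and> L \<inter> R = {} \<and> (\<forall>e\<in>E. \<exists>u\<in>L. \<exists>v\<in>R. e = {u, v})"

definition left_regular :: "'a set \<Rightarrow> 'a set set \<Rightarrow> nat \<Rightarrow> bool" where
  "left_regular L E d \<longleftrightarrow> (\<forall>u\<in>L. card {e \<in> E. u \<in> e} = d)"

definition neighbourhood :: "'a set \<Rightarrow> 'a set set \<Rightarrow> 'a set \<Rightarrow> 'a set" where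
  "neighbourhood R E X = {v \<in> R. \<exists>u\<in>X. {u, v} \<in> E}"

text \<open>
  Meaningful only for \<open>1 \<le> t \<le> card L\<close> with \<open>L\<close> finite; then the minimum ranges over a
  finite nonempty set.
\<close>

definition expansion :: "'a set \<Rightarrow> 'a set \<Rightarrow> 'a set set \<Rightarrow> nat \<Rightarrow> real" where
  "expansion L R E t =
     Min {real (card (neighbourhood R E X)) / real (card X) | X.
            X \<subseteq> L \<and> 0 < card X \<and> card X \<le> t}"

definition optimal_small_set_expander ::
  "'a set \<Rightarrow> 'a set \<Rightarrow> 'a set set \<Rightarrow> nat \<Rightarrow> nat \<Rightarrow> bool" where
  "optimal_small_set_expander L R E d s \<longleftrightarrow>
     bipartite_graph L R E \<and> left_regular L E d \<and>
     (\<forall>t. 1 \<le> t \<and> t \<le> s \<longrightarrow> expansion L R E t \<ge> (real d - 1) + 1 / real t)"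

end

theory Submission
  imports Defs
begin

text \<open>
  Deleting one vertex at a time from a set \<open>X\<close> of size \<open>m\<close>: a vertex of \<open>N(X)\<close> is lost only
  when it has a unique neighbour in \<open>X\<close>, and if \<open>u\<close> counts such vertices, then counting edges
  gives \<open>d m \<ge> u + 2 (|N(X)| - u)\<close>. Hence the sum of \<open>|N(X - {x})|\<close> over \<open>x \<in> X\<close> is at most
  \<open>(m - 2) |N(X)| + d m\<close>. So the defect \<open>d - |N(X)| / |X|\<close> grows by a factor of at most
  \<open>(m - 1) / (m - 2)\<close> when passing from sets of size \<open>m - 1\<close> to sets of size \<open>m\<close>, and these
  factors telescope from \<open>s\<close> to \<open>h\<close>.
\<close>

text \<open>Regrouping each sum by the points of the union reduces the inequality to one that holds
  point by point. The term with factor 2 stands on the left so that no subtraction occurs in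
  \<open>nat\<close>.\<close>

lemma sum_card_UN_delete_le:
  fixes A :: "'b \<Rightarrow> 'a set"
  assumes X: "finite X" and A: "\<And>x. x \<in> X \<Longrightarrow> finite (A x)"
  shows "(\<Sum>x\<in>X. card (\<Union>(A ` (X - {x})))) + 2 * card (\<Union>(A ` X))
           \<le> card X * card (\<Union>(A ` X)) + (\<Sum>x\<in>X. card (A x))"
proof -
  let ?U = "\<Union>(A ` X)"
  have U: "finite ?U" using X A by blast
  \<comment> \<open>Double counting of incidences, used both for the unions after a deletion and for
    the sets \<open>A x\<close> themselves.\<close>
  have swap: "(\<Sum>x\<in>X. card (B x)) = (\<Sum>v\<in>?U. card {x \<in> X. v \<in> B x})"
    if "\<And>x. x \<in> X \<Longrightarrow> B x \<subseteq> ?U" for B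
  proof -
    have "(\<Sum>x\<in>X. card (B x)) = (\<Sum>x\<in>X. card {v \<in> ?U. v \<in> B x})"
      using that by (intro sum.cong refl arg_cong[where f = card]) blast
    also have "\<dots> = (\<Sum>v\<in>?U. card {x \<in> X. v \<in> B x})"
      using sum_multicount_gen[OF X U, of "\<lambda>x v. v \<in> B x"] by simp
    finally show ?thesis .
  qed
  have pointwise: "card {x \<in> X. v \<in> \<Union>(A ` (X - {x}))} + 2 \<le> card X + card {x \<in> X. v \<in> A x}"
    if v: "v \<in> ?U" for v
  proof -
    obtain a where a: "a \<in> X" "v \<in> A a" using v by blast
    \<comment> \<open>A point covered only by \<open>A a\<close> is lost exactly when
      \<open>a\<close> is deleted, which gives equality. A point covered at least twice survives
      every deletion, and its multiplicity pays for the summand 2.\<close>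
    show ?thesis
    proof (cases "{x \<in> X. v \<in> A x} = {a}")
      case True
      then have "{x \<in> X. v \<in> \<Union>(A ` (X - {x}))} = X - {a}" by auto
      moreover have "card X > 0" using a X by (auto simp: card_gt_0_iff)
      ultimately show ?thesis using True a X by (simp add: card_Diff_singleton)
    next
      case False
      then obtain b where b: "b \<in> X" "v \<in> A b" "b \<noteq> a" using a by blast
      have "{x \<in> X. v \<in> \<Union>(A ` (X - {x}))} = X" using a b by auto
      moreover have "card {a, b} \<le> card {x \<in> X. v \<in> A x}"
        using a b X by (intro card_mono) auto
      ultimately show ?thesis using b by simp
    qed
  qed
  have "(\<Sum>x\<in>X. card (\<Union>(A ` (X - {x})))) + 2 * card ?U
      = (\<Sum>v\<in>?U. card {x \<in> X. v \<in> \<Union>(A ` (X - {x}))} + 2)"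
    by (subst swap) (blast, simp only: sum.distrib sum_constant of_nat_id mult.commute)
  also have "\<dots> \<le> (\<Sum>v\<in>?U. card X + card {x \<in> X. v \<in> A x})"
    using pointwise by (rule sum_mono)
  also have "\<dots> = card X * card ?U + (\<Sum>x\<in>X. card (A x))"
    by (subst swap) (auto simp: sum.distrib)
  finally show ?thesis .
qed

lemma neighbourhood_eq_UN: "neighbourhood R E X = (\<Union>u\<in>X. neighbourhood R E {u})"
  by (auto simp: neighbourhood_def)

text \<open>Degrees are defined by counting edges; the bijection from a neighbour \<open>v\<close>
  to the edge \<open>{u, v}\<close> turns them into neighbour counts.\<close>

lemma card_neighbourhood_singleton:
  assumes "bipartite_graph L R E" "left_regular L E d" "u \<in> L"
  shows "card (neighbourhood R E {u}) = d"
proof -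
  have "bij_betw (\<lambda>v. {u, v}) (neighbourhood R E {u}) {e \<in> E. u \<in> e}"
  proof (rule bij_betwI')
    show "({u, v} = {u, w}) = (v = w)" for v w by (auto simp: doubleton_eq_iff)
    show "{u, v} \<in> {e \<in> E. u \<in> e}" if "v \<in> neighbourhood R E {u}" for v
      using that by (auto simp: neighbourhood_def)
    show "\<exists>v\<in>neighbourhood R E {u}. e = {u, v}" if e: "e \<in> {e \<in> E. u \<in> e}" for e
    proof -
      obtain u' v where uv: "u' \<in> L" "v \<in> R" "e = {u', v}"
        using assms(1) e unfolding bipartite_graph_def by blast
      \<comment> \<open>Disjointness of the parts forces \<open>u\<close> to be the end of
        \<open>e\<close> in \<open>L\<close>.\<close>
      moreover have "u \<notin> R" using assms unfolding bipartite_graph_def by blast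
      ultimately have "u' = u" using e by auto
      then show ?thesis using uv e by (auto simp: neighbourhood_def)
    qed
  qed
  then show ?thesis using assms(2,3) bij_betw_same_card unfolding left_regular_def by metis
qed

lemma neighbourhood_delete_bound:
  assumes G: "bipartite_graph L R E" "left_regular L E d" and X: "X \<subseteq> L"
  shows "(\<Sum>x\<in>X. card (neighbourhood R E (X - {x}))) + 2 * card (neighbourhood R E X)
           \<le> card X * card (neighbourhood R E X) + d * card X"
proof -
  have "finite X" "finite R" using G X unfolding bipartite_graph_def by (auto intro: finite_subset)
  moreover have "finite (neighbourhood R E {x})" for x
    using \<open>finite R\<close> by (simp add: neighbourhood_def)
  moreover have "(\<Sum>x\<in>X. card (neighbourhood R E {x})) = d * card X"
    using card_neighbourhood_singleton[OF G] X by (simp add: subset_iff mult.commute)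
  ultimately show ?thesis
    using sum_card_UN_delete_le[of X "\<lambda>u. neighbourhood R E {u}"]
    by (simp flip: neighbourhood_eq_UN)
qed

text \<open>The telescoped factors from \<open>s\<close> to \<open>m\<close> multiply to (m - 1) /
  (s - 1). The induction carries this closed form: the defect of an m-set is at most m - 1 times the
  fixed slope (d - c) / (s - 1), which is d - c at m = s.\<close>

lemma neighbourhood_lower_bound:
  fixes c :: real
  assumes G: "bipartite_graph L R E" "left_regular L E d" and s: "2 \<le> s" "s \<le> m"
    and base: "\<And>Y. Y \<subseteq> L \<Longrightarrow> card Y = s \<Longrightarrow> c * real s \<le> real (card (neighbourhood R E Y))"
    and X: "X \<subseteq> L" "card X = m"
  shows "(real d - (real m - 1) / (real s - 1) * (real d - c)) * real m
           \<le> real (card (neighbourhood R E X))"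
  using s(2) X
proof (induction m arbitrary: X rule: dec_induct)
  case base
  then show ?case using assms(5) s by simp
next
  case (step m)
  let ?N = "\<lambda>Y. real (card (neighbourhood R E Y))"
  let ?r = "(real d - c) / (real s - 1)"
  have m: "real m \<ge> 2" using step s by simp
  have fin: "finite X" using step.prems card_gt_0_iff[of X] by simp
  have "real (Suc m) * ((real d - (real m - 1) * ?r) * real m) = 
      (\<Sum>x\<in>X. (real d - (real m - 1) * ?r) * real m)"
    using step.prems by simp
  also have "\<dots> \<le> (\<Sum>x\<in>X. ?N (X - {x}))"
  proof (rule sum_mono)
    fix x assume "x \<in> X"
    then show "(real d - (real m - 1) * ?r) * real m \<le> ?N (X - {x})"
      using step.IH[of "X - {x}"] step.prems fin by auto
  qed
  \<comment> \<open>Since \<open>card X = Suc m\<close>, the factor \<open>card X - 2\<close> of the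
    deletion bound becomes m - 1.\<close>
  also have "\<dots> \<le> (real m - 1) * ?N X + real d * real (Suc m)"
  proof -
    have "real ((\<Sum>x\<in>X. card (neighbourhood R E (X - {x}))) + 2 * card (neighbourhood R E X))
        \<le> real (card X * card (neighbourhood R E X) + d * card X)"
      using neighbourhood_delete_bound[OF G step.prems(1)] by (rule of_nat_mono)
    then show ?thesis using step.prems(2) by (simp add: algebra_simps)
  qed
  \<comment> \<open>With r for \<open>?r\<close>, this is the identity m (m + 1) (d - (m - 1) r) - d
    (m + 1) = (m - 1) (m + 1) (d - m r); the factor m - 1 is positive and cancels next.\<close>
  finally have "(real m - 1) * ((real d - real m * ?r) * real (Suc m)) \<le> (real m - 1) * ?N X"
    by (simp add: algebra_simps)
  then have "(real d - real m * ?r) * real (Suc m) \<le> ?N X"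
    using m by (simp add: mult_le_cancel_left)
  then show ?case by (simp add: algebra_simps)
qed

lemma finite_expansion_set:
  assumes "finite L"
  shows "finite {real (card (neighbourhood R E X)) / real (card X) | X.
           X \<subseteq> L \<and> 0 < card X \<and> card X \<le> t}"
proof (rule finite_subset)
  show "{real (card (neighbourhood R E X)) / real (card X) | X. X \<subseteq> L \<and> 0 < card X \<and> card X \<le> t}
      \<subseteq> (\<lambda>X. real (card (neighbourhood R E X)) / real (card X)) ` Pow L"
    by blast
qed (use assms in simp)

lemma expansion_le:
  assumes "finite L" "X \<subseteq> L" "0 < card X" "card X \<le> t"
  shows "expansion L R E t \<le> real (card (neighbourhood R E X)) / real (card X)"
  unfolding expansion_def by (rule Min_le[OF finite_expansion_set]) (use assms in auto)

lemma le_expansionI: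
  assumes L: "finite L" "1 \<le> t" "t \<le> card L"
    and "\<And>X. X \<subseteq> L \<Longrightarrow> 0 < card X \<Longrightarrow> card X \<le> t \<Longrightarrow>
           c \<le> real (card (neighbourhood R E X)) / real (card X)"
  shows "c \<le> expansion L R E t"
proof -
  \<comment> \<open>A set of size exactly \<open>t\<close> shows that the minimum ranges over a
    nonempty set.\<close>
  obtain X where X: "X \<subseteq> L" "card X = t" using L obtain_subset_with_card_n by metis
  show ?thesis
    unfolding expansion_def
  proof (rule Min.boundedI[OF finite_expansion_set])
    show "{real (card (neighbourhood R E X)) / real (card X) | X.
             X \<subseteq> L \<and> 0 < card X \<and> card X \<le> t} \<noteq> {}"
      using X L by auto
  qed (use assms in auto)
qed

text \<open>A single vertex attains the ratio d. Hence the defect at \<open>s\<close> is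
  nonnegative, so enlarging its coefficient only weakens a lower bound.\<close>

lemma expansion_le_degree:
  assumes G: "bipartite_graph L R E" "left_regular L E d" and t: "1 \<le> t" "t \<le> card L"
  shows "expansion L R E t \<le> real d"
proof -
  obtain u where "u \<in> L" using t by fastforce
  moreover have "finite L" using G unfolding bipartite_graph_def by blast
  ultimately show ?thesis
    using expansion_le[of L "{u}" t R E] card_neighbourhood_singleton[OF G] t by simp
qed

lemma expansion_extend:
  assumes G: "bipartite_graph L R E" "left_regular L E d"
    and s: "2 \<le> s" "s \<le> h" "h \<le> card L"
  shows "real d - (real h - 1) / (real s - 1) * (real d - expansion L R E s) \<le> expansion L R E h"
proof (rule le_expansionI)
  show L: "finite L" using G unfolding bipartite_graph_def by blast
  show "1 \<le> h" "h \<le> card L" using s by auto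
  let ?c = "expansion L R E s"
  have c: "?c \<le> real d" using expansion_le_degree[OF G] s by simp
  fix X assume X: "X \<subseteq> L" "0 < card X" "card X \<le> h"
  \<comment> \<open>The minimum at \<open>h\<close> also ranges over small sets. Those of size at
    most \<open>s\<close> are controlled by the expansion at \<open>s\<close>, as (h - 1) / (s - 1)
    is at least 1; larger ones by the induction, whose bound decreases with the size.\<close>
  show "real d - (real h - 1) / (real s - 1) * (real d - ?c)
      \<le> real (card (neighbourhood R E X)) / real (card X)"
  proof (cases "card X \<le> s")
    case True
    have "1 * (real d - ?c) \<le> (real h - 1) / (real s - 1) * (real d - ?c)"
      using s c by (intro mult_right_mono) auto
    then have "real d - (real h - 1) / (real s - 1) * (real d - ?c) \<le> ?c"
      by (simp only: mult_1 diff_le_eq add.commute)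
    then show ?thesis using expansion_le[OF L X(1,2) True] by (rule order_trans)
  next
    case False
    have "?c * real s \<le> real (card (neighbourhood R E Y))" if "Y \<subseteq> L" "card Y = s" for Y
      using expansion_le[OF L that(1), of s R E] that(2) s by (simp add: field_simps)
    then have "real d - (real (card X) - 1) / (real s - 1) * (real d - ?c)
        \<le> real (card (neighbourhood R E X)) / real (card X)"
      using neighbourhood_lower_bound[OF G s(1), of "card X" ?c X] X False
      by (simp add: pos_le_divide_eq)
    moreover have "(real (card X) - 1) / (real s - 1) * (real d - ?c)
        \<le> (real h - 1) / (real s - 1) * (real d - ?c)"
      using s c X by (intro mult_right_mono divide_right_mono) auto
    ultimately show ?thesis by linarith
  qed
qed

lemma optimal_expansion_extend:
  assumes G: "optimal_small_set_expander L R E d s" and s: "2 \<le> s" "s \<le> k" "k \<le> card L"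
  shows "real d - (real k - 1) / real s \<le> expansion L R E k"
proof -
  have "(real d - 1) + 1 / real s \<le> expansion L R E s"
    using G s unfolding optimal_small_set_expander_def by simp
  \<comment> \<open>Optimality at t = s bounds the defect by 1 - 1/s = (s - 1)/s, whose numerator
    cancels the denominator s - 1 of the general bound.\<close>
  then have "real d - expansion L R E s \<le> (real s - 1) / real s"
    using s by (simp add: diff_divide_distrib)
  then have "(real k - 1) / (real s - 1) * (real d - expansion L R E s)
      \<le> (real k - 1) / (real s - 1) * ((real s - 1) / real s)"
    using s by (intro mult_left_mono) auto
  also have "\<dots> = (real k - 1) / real s" using s by simp
  finally show ?thesis
    using expansion_extend[of L R E d s k] G s unfolding optimal_small_set_expander_def by linarith
qed

theorem theorem1p7:
  fixes L R :: "'a set" and E :: "'a set set" and d n s h :: nat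
  assumes "bipartite_graph L R E"
    and "left_regular L E d"
    and "n = card L"
    and "s > 0" and "h > 0"
    and "s \<ge> 2"
    and "max s h \<le> n"
  shows "(h \<ge> s \<longrightarrow>
           expansion L R E h \<ge>
             real d - (real h - 1) / (real s - 1) * (real d - expansion L R E s)) \<and>
         (optimal_small_set_expander L R E d s \<longrightarrow>
           (\<forall>k. s \<le> k \<and> k \<le> n \<longrightarrow> expansion L R E k \<ge> real d - (real k - 1) / real s))"
  using expansion_extend[OF assms(1,2)] optimal_expansion_extend assms(3,6,7) by auto

end
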